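(* Let $\zeta_3=e^{2\pi i/3}$ and $Y(t)=t\,\frac{1-t+t^2}{1+2t+4t^2}$. Then for all $u\in\mathbb{C}$ with $0<|u|$ sufficiently small, \[g(u^3)=\sum_{j=0}^{2} g\!\left(Y(\zeta_3^j u)\right).\]
   Context: $g(t)=\mathrm{m}\!\left((x+y)(x+1)(y+1)-\frac1t xy\right)$, where $\mathrm{m}(P)=\int_0^1\int_0^1\log|P(e^{2\pi i\theta_1},e^{2\pi i\theta_2})|d\theta_1d\theta_2$ is the logarithmic Mahler measure. *)

theory Defs
  imports "HOL-Analysis.Analysis"
begin

definition mahler2 :: "(complex \<Rightarrow> complex \<Rightarrow> complex) \<Rightarrow> real" where
  "mahler2 P = (LINT p : {0..1} \<times> {0..1} | (lborel :: (real \<times> real) measure).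
      ln (cmod (P (cis (2 * pi * fst p)) (cis (2 * pi * snd p)))))"

definition g :: "complex \<Rightarrow> real" where
  "g t = mahler2 (\<lambda>x y. (x + y) * (x + 1) * (y + 1) - (1 / t) * x * y)"

definition Y :: "complex \<Rightarrow> complex" where
  "Y t = t * (1 - t + t ^ 2) / (1 + 2 * t + 4 * t ^ 2)"

definition zeta3 :: complex where
  "zeta3 = cis (2 * pi / 3)"

end

theory Submission
  imports Defs "HOL-Complex_Analysis.Laurent_Convergence"
begin

text \<open>
  The constant term of the \<open>n\<close>-th power of \<open>(x + y) (x + 1) (y + 1) / (x y)\<close> is the Franel number
  \<open>f\<^sub>n = \<Sum>\<^sub>k (n choose k)\<^sup>3\<close>, so expanding the logarithm gives
  \<open>g t = - ln |t| - Re (\<Sum>\<^sub>n f\<^sub>n t\<^sup>n / n)\<close> for small \<open>t\<close>. The generating function \<open>F\<close> of the Franel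
  numbers satisfies the cubic transformation \<open>F (Y t) = (1 + 2 t + 4 t\<^sup>2) F (t\<^sup>3)\<close>: after division by
  \<open>1 + 2 t + 4 t\<^sup>2\<close> both sides solve the same second order differential equation, whose exponents at
  the origin are both zero, so that a power series solution is determined by its constant term.
  With \<open>\<psi> t = Y t / t\<close>, the transformation gives
  \<open>t d/dt (Ln (\<psi> t) + \<Sum>\<^sub>n f\<^sub>n (Y t)\<^sup>n / n) = R t * F (t\<^sup>3) - 1\<close> with
  \<open>R t = (1 + t)\<^sup>3 (1 - 2 t)\<^sup>2 / (1 + t\<^sup>3)\<close>, and averaging \<open>R\<close> over the rotations by
  third roots of unity yields \<open>1\<close>. Hence both sides of the theorem have the same derivative.
\<close>

unbundle no vec_syntax

section \<open>Franel numbers: growth and recurrence\<close>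

definition franel :: "nat \<Rightarrow> nat" where
  "franel n = (\<Sum>k\<le>n. (n choose k) ^ 3)"

lemma franel_0: "franel 0 = 1"
  by (simp add: franel_def)

lemma franel_1: "franel 1 = 2"
  by (simp add: franel_def)

text \<open>Two of the three binomial factors are each at most 2^n, and the third sums to 2^n. The
  bound makes the series below converge for norm less than 1/8.\<close>

lemma franel_le: "franel n \<le> 8 ^ n"
proof -
  have "franel n \<le> (\<Sum>k\<le>n. (n choose k) * (2 ^ n * 2 ^ n))"
    unfolding franel_def
  proof (intro sum_mono)
    fix k assume "k \<in> {..n}"
    have "n choose k \<le> 2 ^ n" by (rule binomial_le_pow2)
    then show "(n choose k) ^ 3 \<le> (n choose k) * (2 ^ n * 2 ^ n)"
      by (simp add: power3_eq_cube mult_le_mono)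
  qed
  also have "\<dots> = 2 ^ n * (2 ^ n * 2 ^ n)"
    by (simp only: sum_distrib_right [symmetric] choose_row_sum)
  also have "\<dots> = (8::nat) ^ n"
    by (simp flip: power_mult_distrib)
  finally show ?thesis .
qed

text \<open>Lets the three Franel numbers in the recurrence share one summation range, over which
  the certificate telescopes.\<close>

lemma franel_eq_sum: "n \<le> m \<Longrightarrow> franel n = (\<Sum>k\<le>m. (n choose k) ^ 3)"
  unfolding franel_def by (intro sum.mono_neutral_left) auto

lemma franel_recurrence:
  "real (n + 2) ^ 2 * real (franel (n + 2)) =
     (7 * real n ^ 2 + 21 * real n + 16) * real (franel (n + 1)) + 8 * real (n + 1) ^ 2 * real (franel n)"
proof -
  \<comment> \<open>Zeilberger's certificate: \<open>G\<close> telescopes the recurrence for the summands. Both are expressed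
    through \<open>c k\<close>, which makes all quotients polynomial, including the vanishing binomials at
    \<open>k = n + 1\<close> and \<open>k = n + 2\<close>.\<close>
  define P :: "real \<Rightarrow> real" where
    "P = (\<lambda>k. (real n + 1) ^ 2 * (4 * k ^ 3 - (18 * real n + 30) * k ^ 2
        + (27 * real n ^ 2 + 93 * real n + 78) * k
        - (14 * real n ^ 3 + 74 * real n ^ 2 + 128 * real n + 72)))"
  define c :: "nat \<Rightarrow> real" where "c = (\<lambda>k. fact n / (fact k * fact (n + 2 - k)))"
  define G where "G = (\<lambda>k. P (real k) * (if k \<le> n + 2 then c k * real k else 0) ^ 3)"
  have step: "real (n + 2) ^ 2 * real (n + 2 choose k) ^ 3
      - (7 * real n ^ 2 + 21 * real n + 16) * real (n + 1 choose k) ^ 3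
      - 8 * real (n + 1) ^ 2 * real (n choose k) ^ 3 = G (Suc k) - G k" if k: "k \<le> n + 2" for k
  proof -
    obtain d where d: "n + 2 = k + d" using k le_Suc_ex by blast
    have rd: "real k = real n + 2 - real d" using d by linarith
    have c: "c k = fact n / (fact k * fact d)" unfolding c_def using d by simp
    have b2: "real (n + 2 choose k) = c k * (real n + 1) * (real n + 2)"
    proof -
      have "fact (n + 2) = (real n + 1) * (real n + 2) * fact n" by (simp add: algebra_simps)
      moreover have "real (n + 2 choose k) = fact (n + 2) / (fact k * fact d)"
        using d binomial_fact [OF k] by simp
      ultimately show ?thesis by (simp add: c)
    qed
    have b1: "real (n + 1 choose k) = c k * (real n + 1) * real d"
    proof (cases d)
      case 0 then show ?thesis using d by simp
    next
      case (Suc e)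
      then have "n + 1 = k + e" using d by simp
      then have "real (n + 1 choose k) = fact (n + 1) / (fact k * fact e)"
        by (simp add: binomial_fact)
      then show ?thesis by (simp add: c Suc divide_simps)
    qed
    have b0: "real (n choose k) = c k * (real d - 1) * real d"
    proof (cases "d < 2")
      case True
      then have "d = 0 \<or> d = 1" by linarith
      then show ?thesis using d by auto
    next
      case False
      then obtain e where e: "d = Suc (Suc e)" by (metis add_2_eq_Suc le_Suc_ex not_less)
      then have "n = k + e" using d by simp
      then have "real (n choose k) = fact n / (fact k * fact e)"
        by (simp add: binomial_fact)
      then show ?thesis by (simp add: c e divide_simps)
    qed
    have G0: "G k = P (real k) * (c k * real k) ^ 3" using k by (simp add: G_def)
    have G1: "G (Suc k) = P (real k + 1) * (c k * real d) ^ 3"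
    proof (cases d)
      case 0 then show ?thesis using d by (simp add: G_def)
    next
      case (Suc e)
      then have e: "n + 2 - Suc k = e" using d by simp
      have "c (Suc k) * real (Suc k) = c k * real d"
        unfolding c unfolding c_def e by (simp add: Suc divide_simps del: of_nat_Suc)
      then show ?thesis using d Suc by (simp add: G_def add.commute)
    qed
    show ?thesis
      unfolding b2 b1 b0 G0 G1 P_def rd by (simp add: power_mult_distrib) algebra
  qed
  have "real (n + 2) ^ 2 * real (franel (n + 2))
      - (7 * real n ^ 2 + 21 * real n + 16) * real (franel (n + 1))
      - 8 * real (n + 1) ^ 2 * real (franel n) = (\<Sum>k\<le>n + 2. G (Suc k) - G k)"
    by (simp add: franel_eq_sum [of _ "n + 2"] sum_distrib_left sum_subtractf step [symmetric]
             del: sum.atMost_Suc)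
  also have "\<dots> = G (Suc (n + 2)) - G 0"
    by (simp only: lessThan_Suc_atMost [symmetric] sum_lessThan_telescope)
  \<comment> \<open>\<open>G 0\<close> has a factor 0, and the guard in \<open>G\<close> makes
    \<open>G (n + 3)\<close> vanish, where truncated subtraction would leave \<open>c\<close>
    nonzero.\<close>
  also have "\<dots> = 0" by (simp add: G_def)
  finally show ?thesis by simp
qed

section \<open>Differential equation of the Franel series and its pullbacks\<close>

definition franel_fps :: "complex fps" where
  "franel_fps = Abs_fps (\<lambda>n. of_nat (franel n))"

text \<open>Comparing coefficients of X^m gives the recurrence with n = m - 1; for m = 0 it gives
  f_1 = 2 f_0. The singular points are visible from 1 - 7 X - 8 X^2 = (1 + X) (1 - 8 X).\<close>

lemma franel_fps_ode:
  "fps_deriv (fps_X * (1 - 7 * fps_X - 8 * fps_X ^ 2) * fps_deriv franel_fps)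
     = (2 + 8 * fps_X) * franel_fps"
proof (rule fps_ext)
  fix m
  define D where "D = fps_deriv franel_fps"
  have eq: "fps_X * (1 - 7 * fps_X - 8 * fps_X ^ 2) * D
      = fps_X * D - fps_const 7 * (fps_X * (fps_X * D)) - fps_const 8 * (fps_X * (fps_X * (fps_X * D)))"
    by (simp add: algebra_simps power2_eq_square fps_numeral_fps_const)
  have eq2: "(2 + 8 * fps_X) * franel_fps = fps_const 2 * franel_fps + fps_const 8 * (fps_X * franel_fps)"
    by (simp add: algebra_simps fps_numeral_fps_const)
  have rec: "of_nat (n + 2) ^ 2 * (of_nat (franel (n + 2)) :: complex) =
     (7 * of_nat n ^ 2 + 21 * of_nat n + 16) * of_nat (franel (n + 1))
       + 8 * of_nat (n + 1) ^ 2 * of_nat (franel n)" for n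
    using arg_cong [OF franel_recurrence [of n], of complex_of_real] by simp
  show "fps_deriv (fps_X * (1 - 7 * fps_X - 8 * fps_X ^ 2) * fps_deriv franel_fps) $ m
     = ((2 + 8 * fps_X) * franel_fps) $ m"
  proof (cases m)
    case 0
    then show ?thesis
      unfolding D_def [symmetric] eq eq2
      by (simp add: D_def franel_fps_def franel_0 franel_1 [simplified])
  next
    case (Suc n)
    show ?thesis
      unfolding D_def [symmetric] eq eq2 Suc
      using rec [of n] by (cases n) (simp_all add: D_def franel_fps_def algebra_simps power2_eq_square)
  qed
qed

lemma fps_deriv_power2: "fps_deriv (f ^ 2) = 2 * f * fps_deriv (f :: 'a::comm_ring_1 fps)"
  by (simp add: power2_eq_square algebra_simps mult_2)

lemma fps_deriv_power3: "fps_deriv (f ^ 3) = 3 * f ^ 2 * fps_deriv (f :: 'a::comm_ring_1 fps)"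
  by (simp add: power3_eq_cube power2_eq_square algebra_simps)

text \<open>The coefficient of X^m on the left contains f_{m+1} with factor (m+1)^2 *
  \<open>A $ 0\<close>, and everything else involves only lower coefficients of \<open>f\<close>. So
  the vanishing of \<open>f $ 0\<close> propagates.\<close>

lemma fps_ode_solution_eq_0:
  fixes f A B :: "'a::field_char_0 fps"
  assumes ode: "fps_deriv (fps_X * A * fps_deriv f) = B * f"
    and A: "A $ 0 \<noteq> 0" and f0: "f $ 0 = 0"
  shows "f = 0"
proof (rule fps_ext)
  fix n
  show "f $ n = 0 $ n"
  proof (induction n rule: less_induct)
    case (less n)
    show ?case
    proof (cases n)
      case 0 then show ?thesis using f0 by simp
    next
      case (Suc m)
      have "(B * f) $ m = (\<Sum>i=0..m. B $ i * f $ (m - i))" by (simp add: fps_mult_nth)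
      also have "\<dots> = 0" using less Suc by (intro sum.neutral) auto
      finally have "of_nat (Suc m) * (A * fps_deriv f) $ m = 0"
        unfolding ode [symmetric] by (simp add: mult.assoc del: fps_deriv_mult of_nat_Suc)
      then have "(A * fps_deriv f) $ m = 0" by (metis mult_eq_0_iff of_nat_eq_0_iff nat.distinct(1))
      moreover have "(A * fps_deriv f) $ m = (\<Sum>i=0..m. A $ i * fps_deriv f $ (m - i))"
        by (simp add: fps_mult_nth)
      moreover have "\<dots> = (\<Sum>i\<in>{0}. A $ i * fps_deriv f $ (m - i))"
        using less Suc by (intro sum.mono_neutral_right) auto
      ultimately have "A $ 0 * (of_nat (Suc m) * f $ Suc m) = 0" by simp
      then show ?thesis using A Suc by (simp del: of_nat_Suc)
    qed
  qed
qed

text \<open>Derivatives of \<open>franel_fps\<close> are composed with \<open>y\<close> separately,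
  and the chain rule is recorded as two further relations. Equations for pullbacks then follow by
  polynomial elimination.\<close>

lemma franel_fps_ode_compose:
  fixes y :: "complex fps"
  assumes "y $ 0 = 0"
  defines "F\<^sub>1 \<equiv> fps_deriv franel_fps oo y"
  defines "F\<^sub>2 \<equiv> fps_deriv (fps_deriv franel_fps) oo y"
  shows "(y - 7 * y ^ 2 - 8 * y ^ 3) * F\<^sub>2 + (1 - 14 * y - 24 * y ^ 2) * F\<^sub>1 = (2 + 8 * y) * (franel_fps oo y)"
    and "fps_deriv (franel_fps oo y) = F\<^sub>1 * fps_deriv y"
    and "fps_deriv F\<^sub>1 = F\<^sub>2 * fps_deriv y"
proof -
  note compose = fps_compose_mult_distrib [OF assms(1)] fps_compose_add_distrib
    fps_compose_sub_distrib fps_compose_power [OF assms(1), symmetric]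
  have num: "numeral k oo y = numeral k" for k
    by (simp add: fps_numeral_fps_const)
  have "(fps_X - 7 * fps_X ^ 2 - 8 * fps_X ^ 3) * fps_deriv (fps_deriv franel_fps)
      + (1 - 14 * fps_X - 24 * fps_X ^ 2) * fps_deriv franel_fps = (2 + 8 * fps_X) * franel_fps"
    using franel_fps_ode by (simp add: fps_deriv_power2 fps_deriv_power3) algebra
  from arg_cong [OF this, of "\<lambda>f. f oo y"]
  show "(y - 7 * y ^ 2 - 8 * y ^ 3) * F\<^sub>2 + (1 - 14 * y - 24 * y ^ 2) * F\<^sub>1 = (2 + 8 * y) * (franel_fps oo y)"
    unfolding F\<^sub>1_def F\<^sub>2_def by (simp add: compose num assms(1))
  show "fps_deriv (franel_fps oo y) = F\<^sub>1 * fps_deriv y" "fps_deriv F\<^sub>1 = F\<^sub>2 * fps_deriv y"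
    unfolding F\<^sub>1_def F\<^sub>2_def by (rule fps_compose_deriv [OF assms(1)])+
qed

text \<open>Cubing the variable triples the exponents at the origin, so both stay zero. The
  resulting equation is the common target for the two sides of the cubic transformation.\<close>

lemma franel_fps_cube_ode:
  defines "K \<equiv> franel_fps oo fps_X ^ 3"
  shows "fps_deriv (fps_X * ((1 + fps_X ^ 3) * (1 - 8 * fps_X ^ 3)) * fps_deriv K)
           = (18 * fps_X ^ 2 * (1 + 4 * fps_X ^ 3)) * K"
proof -
  define F1 where "F1 = fps_deriv franel_fps oo (fps_X ^ 3 :: complex fps)"
  define F2 where "F2 = fps_deriv (fps_deriv franel_fps) oo (fps_X ^ 3 :: complex fps)"
  have "(fps_X ^ 3 :: complex fps) $ 0 = 0" by simp
  note ode = franel_fps_ode_compose [OF this, folded F1_def F2_def K_def]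
  have dX: "fps_deriv (fps_X ^ 3 :: complex fps) = 3 * fps_X ^ 2"
    by (simp add: fps_deriv_power2 fps_deriv_power3)
  have eq: "fps_X * ((1 + fps_X ^ 3) * (1 - 8 * fps_X ^ 3)) * fps_deriv K
      = 3 * (fps_X ^ 3 * ((1 + fps_X ^ 3) * (1 - 8 * fps_X ^ 3)) * F1)"
    unfolding ode(2) dX by algebra
  show ?thesis
    unfolding eq using ode(1) by (simp add: dX ode(3)) algebra
qed

definition Y_fps :: "complex fps" where
  "Y_fps = fps_X * (1 - fps_X + fps_X ^ 2) / (1 + 2 * fps_X + 4 * fps_X ^ 2)"

text \<open>The pullback along \<open>Y_fps\<close> is rewritten for the quotient by
  \<open>w\<close>: denominators are cleared by powers of \<open>w\<close>, then \<open>F1\<close>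
  and \<open>F2\<close> are eliminated in favour of the derivatives of \<open>E\<close>.\<close>

lemma Y_fps_quotient_ode:
  fixes E :: "complex fps"
  defines "w \<equiv> 1 + 2 * fps_X + 4 * fps_X ^ 2 :: complex fps"
  assumes E: "w * E = franel_fps oo Y_fps"
  shows "fps_deriv (fps_X * ((1 + fps_X ^ 3) * (1 - 8 * fps_X ^ 3)) * fps_deriv E)
           = (18 * fps_X ^ 2 * (1 + 4 * fps_X ^ 3)) * E"
proof -
  define X where "X = (fps_X :: complex fps)"
  define v where "v = 1 - X + X ^ 2"
  \<comment> \<open>The derivative of \<open>y\<close> turns out to be (a/w)^2. The zeros -1 and 1/2
    of \<open>a\<close> are the points where Y takes the values -1 and 1/8, the singular points of
    the Franel equation.\<close>
  define a where "a = (1 + X) * (1 - 2 * X)"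
  define y where "y = Y_fps"
  define y1 where "y1 = fps_deriv y"
  define y2 where "y2 = fps_deriv y1"
  define F1 where "F1 = fps_deriv franel_fps oo y"
  define F2 where "F2 = fps_deriv (fps_deriv franel_fps) oo y"
  define E1 where "E1 = fps_deriv E"
  define E2 where "E2 = fps_deriv E1"
  define H where "H = franel_fps oo y"
  have dX: "fps_deriv X = 1" by (simp add: X_def)
  have w: "w = 1 + 2 * X + 4 * X ^ 2" by (simp add: w_def X_def)
  have w0: "w $ 0 = 1" by (simp add: w X_def)
  then have wnz: "w \<noteq> 0" by (metis fps_zero_nth zero_neq_one)
  have wy: "w * y = X * v"
    unfolding y_def Y_fps_def X_def [symmetric] v_def [symmetric] w [symmetric]
    using w0 by (metis fps_divide_times_eq fps_unit_dvd dvd_mult_div_cancel one_neq_zero unit_imp_dvd)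
  have y0: "y $ 0 = 0"
    using arg_cong [OF wy, of "\<lambda>f. f $ 0"] w0 by (simp add: X_def)
  note ode = franel_fps_ode_compose [OF y0, folded F1_def F2_def H_def y1_def]
  have dw: "fps_deriv w = 2 + 8 * X" by (simp add: w dX fps_deriv_power2 fps_deriv_power3)
  have B: "(2 + 8 * X) * y + w * y1 = 1 - 2 * X + 3 * X ^ 2"
    using arg_cong [OF wy, of fps_deriv]
    by (simp add: dw y1_def [symmetric] v_def dX fps_deriv_power2 fps_deriv_power3) algebra
  have y1: "w ^ 2 * y1 = a ^ 2"
    using wy B unfolding a_def v_def w by algebra
  have da: "fps_deriv a = - 1 - 4 * X"
    by (simp add: a_def dX)
  have y2: "w ^ 3 * y2 = w * (2 * a * (- 1 - 4 * X)) - 2 * (2 + 8 * X) * a ^ 2"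
  proof -
    have "2 * w * (2 + 8 * X) * y1 + w ^ 2 * y2 = 2 * a * (- 1 - 4 * X)"
      using arg_cong [OF y1, of fps_deriv]
      by (simp add: dw da y2_def [symmetric] power2_eq_square) algebra
    then show ?thesis using y1 by algebra
  qed
  have H1: "(2 + 8 * X) * E + w * E1 = F1 * y1"
    using ode(2) unfolding H_def y_def E [symmetric] by (simp add: dw E1_def [symmetric] add.commute)
  have H2: "8 * E + 2 * (2 + 8 * X) * E1 + w * E2 = F2 * y1 ^ 2 + F1 * y2"
    using arg_cong [OF H1, of fps_deriv]
    by (simp add: dw E1_def [symmetric] E2_def [symmetric] ode(3) y2_def [symmetric] dX) algebra
  \<comment> \<open>Y is totally ramified over -1 and 1/8, so \<open>1 + y\<close> and
    \<open>1 - 8 * y\<close> are cubes up to the factor \<open>w\<close>.\<close>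
  have P1: "w ^ 3 * (y - 7 * y ^ 2 - 8 * y ^ 3) = X * v * a ^ 3"
  proof -
    have "w * (1 + y) = (1 + X) ^ 3" "w * (1 - 8 * y) = (1 - 2 * X) ^ 3"
      using wy unfolding v_def w by algebra+
    then show ?thesis using wy unfolding a_def by algebra
  qed
  have S0: "X * v * a ^ 3 * F2 + w * (w ^ 2 - 14 * X * v * w - 24 * X ^ 2 * v ^ 2) * F1
      = w ^ 2 * (2 * w + 8 * X * v) * H"
    using ode(1) P1 wy by algebra
  have q1: "a ^ 2 * F1 = w ^ 2 * ((2 + 8 * X) * E + w * E1)"
    using H1 y1 by algebra
  have q2: "a ^ 4 * F2 = w ^ 4 * (8 * E + 2 * (2 + 8 * X) * E1 + w * E2)
      - F1 * w * (w * (2 * a * (- 1 - 4 * X)) - 2 * (2 + 8 * X) * a ^ 2)"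
    using H2 y1 y2 by algebra
  have wE: "H = w * E" using E by (simp add: H_def y_def)
  \<comment> \<open>\<open>H1'\<close> and \<open>H2'\<close> are the first two derivatives of
    \<open>w * E\<close>. These four quantities stay opaque until \<open>w ^ 3\<close> is cancelled,
    which keeps the elimination small.\<close>
  define r where "r = w ^ 2 - 14 * X * v * w - 24 * X ^ 2 * v ^ 2"
  define s where "s = 2 * w + 8 * X * v"
  define H1' where "H1' = (2 + 8 * X) * E + w * E1"
  define H2' where "H2' = 8 * E + 2 * (2 + 8 * X) * E1 + w * E2"
  have "X * v * a * (a ^ 4 * F2) + w * r * (a ^ 2 * F1)
      = a ^ 2 * w ^ 3 * s * E"
    using S0 unfolding wE r_def [symmetric] s_def [symmetric] by algebra
  \<comment> \<open>The extra factor \<open>a\<close> completes \<open>a ^ 2 * F1\<close>, which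
    \<open>q1\<close> can replace.\<close>
  moreover have "a * (a ^ 4 * F2) = a * w ^ 4 * H2'
      - (a ^ 2 * F1) * w * (2 * w * (- 1 - 4 * X) - 2 * (2 + 8 * X) * a)"
    using q2 unfolding H2'_def [symmetric] by algebra
  ultimately have "X * v * a * w ^ 4 * H2' - X * v * w ^ 3 * H1' * (2 * w * (- 1 - 4 * X) - 2 * (2 + 8 * X) * a)
      + w ^ 3 * r * H1' = a ^ 2 * w ^ 3 * s * E"
    using q1 unfolding H1'_def [symmetric] by algebra
  then have "w ^ 3 * (X * v * a * w * H2' - X * v * H1' * (2 * w * (- 1 - 4 * X) - 2 * (2 + 8 * X) * a)
      + r * H1') = w ^ 3 * (a ^ 2 * s * E)"
    by algebra
  then have "X * v * a * w * H2' - X * v * H1' * (2 * w * (- 1 - 4 * X) - 2 * (2 + 8 * X) * a)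
      + r * H1' = a ^ 2 * s * E"
    using wnz by simp
  then have "w * (X * v * a * w * E2 + (1 - 28 * X ^ 3 - 56 * X ^ 6) * E1) = w * ((18 * X ^ 2 * (1 + 4 * X ^ 3)) * E)"
    unfolding H1'_def H2'_def r_def s_def v_def a_def w by algebra
  then have "X * v * a * w * E2 + (1 - 28 * X ^ 3 - 56 * X ^ 6) * E1 = (18 * X ^ 2 * (1 + 4 * X ^ 3)) * E"
    using wnz by simp
  \<comment> \<open>\<open>v * a * w\<close> equals (1 + X^3) (1 - 8 X^3), and 1 - 28 X^3 - 56 X^6
    is the derivative of X times this product.\<close>
  then show ?thesis
    unfolding X_def [symmetric] E1_def [symmetric]
    by (simp add: dX E2_def [symmetric] fps_deriv_power2 fps_deriv_power3 v_def a_def w) algebra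
qed

theorem franel_fps_cubic_transformation:
  "franel_fps oo Y_fps = (1 + 2 * fps_X + 4 * fps_X ^ 2) * (franel_fps oo fps_X ^ 3)"
proof -
  define w where "w = (1 + 2 * fps_X + 4 * fps_X ^ 2 :: complex fps)"
  define E where "E = inverse w * (franel_fps oo Y_fps)"
  define K where "K = franel_fps oo (fps_X ^ 3 :: complex fps)"
  have w0: "w $ 0 = 1" by (simp add: w_def)
  then have wE: "w * E = franel_fps oo Y_fps"
    by (simp add: E_def mult.assoc [symmetric] inverse_mult_eq_1' )
  have "E - K = 0"
  proof (rule fps_ode_solution_eq_0)
    show "fps_deriv (fps_X * ((1 + fps_X ^ 3) * (1 - 8 * fps_X ^ 3)) * fps_deriv (E - K))
        = (18 * fps_X ^ 2 * (1 + 4 * fps_X ^ 3)) * (E - K)"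
      using Y_fps_quotient_ode [OF wE [unfolded w_def]] franel_fps_cube_ode
      unfolding K_def fps_deriv_sub right_diff_distrib by simp
    show "((1 + fps_X ^ 3) * (1 - 8 * fps_X ^ 3) :: complex fps) $ 0 \<noteq> 0"
      by simp
    show "(E - K) $ 0 = 0" using w0 by (simp add: E_def K_def)
  qed
  then show ?thesis using wE by (simp add: w_def K_def)
qed

section \<open>Constant terms on the torus and the series for \<open>g\<close>\<close>

lemma has_integral_cis_period:
  "((\<lambda>s. cis (2 * pi * (of_int k * s))) has_integral (if k = 0 then 1 else 0)) {0..1}"
proof (cases "k = 0")
  case True
  then show ?thesis using has_integral_const_real [of "1::complex" 0 1] by simp
next
  case False
  define c where "c = 2 * pi * of_int k"
  have c: "c \<noteq> 0" using False by (simp add: c_def)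
  have "((\<lambda>s. cis (c * s)) has_integral (cis (c * 1) / (\<i> * c) - cis (c * 0) / (\<i> * c))) {0..1}"
  proof (rule fundamental_theorem_of_calculus)
    fix s :: real
    have "((\<lambda>s. cis (c * s)) has_vector_derivative (c *\<^sub>R (\<i> * cis (c * s)))) (at s within {0..1})"
    proof -
      have "((\<lambda>z. exp (\<i> * (of_real c * z))) has_field_derivative of_real c * (\<i> * exp (\<i> * (of_real c * of_real s))))
          (at (of_real s))"
        by (auto intro!: derivative_eq_intros)
      from has_vector_derivative_real_field [OF this] show ?thesis
        by (simp add: cis_conv_exp scaleR_conv_of_real)
    qed
    from has_vector_derivative_divide [OF this, of "\<i> * c"]
    show "((\<lambda>s. cis (c * s) / (\<i> * c)) has_vector_derivative cis (c * s)) (at s within {0..1})"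
      using c by (simp add: scaleR_conv_of_real)
  qed auto
  moreover have "cis c = 1"
    unfolding c_def by (rule cis_multiple_2pi) auto
  ultimately show ?thesis using False by (simp add: c_def mult.assoc)
qed

lemma has_integral_cis_period2:
  "((\<lambda>p. cis (2 * pi * (of_int k * fst p + of_int l * snd p))) has_integral
     (if k = 0 \<and> l = 0 then 1 else 0)) (cbox (0, 0) (1, 1))"
proof -
  define f where "f = (\<lambda>p. cis (2 * pi * (of_int k * fst p + of_int l * snd p)))"
  have cont: "continuous_on (cbox (0, 0) (1, 1)) f"
    unfolding f_def by (intro continuous_intros)
  have eq: "f (x, y) = cis (2 * pi * (of_int k * x)) * cis (2 * pi * (of_int l * y))" for x y
    by (simp add: f_def cis_mult distrib_left)
  have "integral (cbox (0, 0) (1, 1)) f = (if k = 0 then 1 else 0) * (if l = 0 then 1 else 0)"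
    unfolding integral_prod_continuous [OF cont] eq
    using integral_unique [OF has_integral_cis_period] by simp
  then show ?thesis
    using integrable_integral [OF integrable_continuous [OF cont]] by (auto simp: f_def split: if_splits)
qed

text \<open>On the torus the polynomial in \<open>g\<close> is -x y / t times
  \<open>1 - t * laurent p\<close>, which is close to 1 for small \<open>t\<close>.\<close>

definition laurent :: "real \<times> real \<Rightarrow> complex" where
  "laurent p = (let x = cis (2 * pi * fst p); y = cis (2 * pi * snd p) in
     (x + y) * (x + 1) * (y + 1) / (x * y))"

lemma continuous_on_laurent: "continuous_on S laurent"
  unfolding laurent_def Let_def by (intro continuous_intros) auto

lemma norm_laurent_le: "norm (laurent p) \<le> 8"
proof -
  define x y where "x = cis (2 * pi * fst p)" and "y = cis (2 * pi * snd p)"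
  have "norm (x + y) \<le> 2" "norm (x + 1) \<le> 2" "norm (y + 1) \<le> 2"
    using norm_triangle_ineq [of x y] norm_triangle_ineq [of x 1] norm_triangle_ineq [of y 1]
    by (simp_all add: x_def y_def)
  then have "norm (x + y) * norm (x + 1) * norm (y + 1) \<le> 2 * 2 * 2"
    by (intro mult_mono) auto
  then show ?thesis
    by (simp add: laurent_def Let_def norm_mult norm_divide x_def y_def)
qed

text \<open>In the product of three binomial expansions only terms with b = n - a and c = a are
  constant on the torus; by symmetry of the binomial coefficients each contributes a cube.\<close>

lemma has_integral_laurent_power:
  "((\<lambda>p. laurent p ^ n) has_integral of_nat (franel n)) (cbox (0, 0) (1, 1))"
proof -
  \<comment> \<open>The indices count the factors x taken from x + y, x from x + 1 and y from y + 1.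
    After division by x^n y^n the exponents are a + b - n and c - a.\<close>
  define h where "h = (\<lambda>a b c (p :: real \<times> real). of_nat ((n choose a) * (n choose b) * (n choose c)) *
    cis (2 * pi * (of_int (int a + int b - int n) * fst p + of_int (int c - int a) * snd p)))"
  have eq: "laurent p ^ n = (\<Sum>a\<le>n. \<Sum>b\<le>n. \<Sum>c\<le>n. h a b c p)" for p
  proof -
    define x y where "x = cis (2 * pi * fst p)" and "y = cis (2 * pi * snd p)"
    have "laurent p ^ n = (x + y) ^ n * (x + 1) ^ n * (y + 1) ^ n / (x ^ n * y ^ n)"
      by (simp add: laurent_def Let_def x_def y_def power_mult_distrib power_divide)
    also have "\<dots> = (\<Sum>a\<le>n. \<Sum>b\<le>n. \<Sum>c\<le>n. of_nat ((n choose a) * (n choose b) * (n choose c)) *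
        (x ^ a * y ^ (n - a) * x ^ b * y ^ c / (x ^ n * y ^ n)))"
      unfolding binomial_ring
      by (simp add: sum_distrib_left sum_distrib_right sum_divide_distrib mult_ac)
    also have "\<dots> = (\<Sum>a\<le>n. \<Sum>b\<le>n. \<Sum>c\<le>n. h a b c p)"
    proof (intro sum.cong refl)
      fix a b c assume "a \<in> {..n}" "b \<in> {..n}" "c \<in> {..n}"
      then have "x ^ a * y ^ (n - a) * x ^ b * y ^ c / (x ^ n * y ^ n) =
          cis (2 * pi * (of_int (int a + int b - int n) * fst p + of_int (int c - int a) * snd p))"
        by (simp add: x_def y_def Complex.DeMoivre cis_mult cis_divide of_nat_diff algebra_simps)
      then show "of_nat ((n choose a) * (n choose b) * (n choose c)) *
          (x ^ a * y ^ (n - a) * x ^ b * y ^ c / (x ^ n * y ^ n)) = h a b c p"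
        by (simp add: h_def)
    qed
    finally show ?thesis .
  qed
  have "((\<lambda>p. \<Sum>a\<le>n. \<Sum>b\<le>n. \<Sum>c\<le>n. h a b c p) has_integral
      (\<Sum>a\<le>n. \<Sum>b\<le>n. \<Sum>c\<le>n. of_nat ((n choose a) * (n choose b) * (n choose c)) *
        (if int a + int b - int n = 0 \<and> int c - int a = 0 then 1 else 0))) (cbox (0, 0) (1, 1))"
    unfolding h_def
    by (intro has_integral_sum has_integral_mult_right has_integral_cis_period2) auto
  also have "(\<Sum>a\<le>n. \<Sum>b\<le>n. \<Sum>c\<le>n. of_nat ((n choose a) * (n choose b) * (n choose c)) *
        (if int a + int b - int n = 0 \<and> int c - int a = 0 then 1 else 0))
      = (\<Sum>a\<le>n. of_nat ((n choose a) ^ 3) :: complex)"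
  proof (intro sum.cong refl)
    fix a assume a: "a \<in> {..n}"
    have "(\<Sum>b\<le>n. \<Sum>c\<le>n. of_nat ((n choose a) * (n choose b) * (n choose c)) *
        (if int a + int b - int n = 0 \<and> int c - int a = 0 then 1 else 0))
      = (\<Sum>b\<le>n. if b = n - a then \<Sum>c\<le>n. if c = a then
            of_nat ((n choose a) * (n choose b) * (n choose c)) else 0 else (0::complex))"
    proof (intro sum.cong refl)
      fix b assume "b \<in> {..n}"
      show "(\<Sum>c\<le>n. of_nat ((n choose a) * (n choose b) * (n choose c)) *
          (if int a + int b - int n = 0 \<and> int c - int a = 0 then 1 else 0))
        = (if b = n - a then \<Sum>c\<le>n. if c = a then
            of_nat ((n choose a) * (n choose b) * (n choose c)) else 0 else (0::complex))"
      proof (cases "b = n - a")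
        case True
        then have "int a + int b - int n = 0" using a by simp
        then show ?thesis unfolding if_P [OF True] by (intro sum.cong refl) simp
      next
        case False
        then have "int a + int b - int n \<noteq> 0" using a by auto
        then show ?thesis unfolding if_not_P [OF False] by simp
      qed
    qed
    also have "\<dots> = of_nat ((n choose a) * (n choose (n - a)) * (n choose a))"
      using a by simp
    also have "n choose (n - a) = n choose a"
      using a by (simp add: binomial_symmetric [of a n])
    finally show "(\<Sum>b\<le>n. \<Sum>c\<le>n. of_nat ((n choose a) * (n choose b) * (n choose c)) *
        (if int a + int b - int n = 0 \<and> int c - int a = 0 then 1 else 0))
      = (of_nat ((n choose a) ^ 3) :: complex)" by (simp add: power3_eq_cube)
  qed
  also have "\<dots> = of_nat (franel n)" by (simp add: franel_def)
  finally show ?thesis unfolding eq .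
qed

text \<open>The constant coefficient is \<open>f\<^sub>0 / 0 = 0\<close>.\<close>
definition franel_log_fps :: "complex fps" where
  "franel_log_fps = Abs_fps (\<lambda>n. of_nat (franel n) / of_nat n)"

text \<open>Since \<open>laurent\<close> is bounded by 8, the logarithm series is dominated by a
  geometric series uniformly on the square and may be integrated term by term.\<close>

lemma has_integral_Ln_laurent:
  assumes t: "norm t < 1 / 8"
  shows "((\<lambda>p. Ln (1 - t * laurent p)) has_integral - eval_fps franel_log_fps t) (cbox (0, 0) (1, 1))"
proof -
  \<comment> \<open>The term n = 0 is zero, since division by zero yields zero.\<close>
  define f where "f = (\<lambda>N p. \<Sum>n<N. - (t ^ n / of_nat n) * laurent p ^ n)"
  have small: "norm (t * laurent p) \<le> 8 * norm t" for p
    using mult_left_mono [OF norm_laurent_le [of p], of "norm t"] by (simp add: norm_mult mult.commute)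
  have sums: "(\<lambda>n. - (t ^ n / of_nat n) * laurent p ^ n) sums Ln (1 - t * laurent p)" for p
  proof -
    have "norm (- (t * laurent p)) < 1" using small [of p] t by simp
    from Ln_series' [OF this] show ?thesis by (simp add: power_mult_distrib)
  qed
  have "uniform_limit (cbox (0, 0) (1, 1)) f (\<lambda>p. \<Sum>n. - (t ^ n / of_nat n) * laurent p ^ n) sequentially"
    unfolding f_def
  proof (rule Weierstrass_m_test)
    fix n and p :: "real \<times> real"
    have "norm (- (t ^ n / of_nat n) * laurent p ^ n) = norm (t * laurent p) ^ n / real n"
      by (simp add: norm_mult norm_divide norm_power power_mult_distrib)
    also have "\<dots> \<le> norm (t * laurent p) ^ n"
      using divide_left_mono [of 1 "real n" "norm (t * laurent p) ^ n"] by (cases "n = 0") auto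
    also have "\<dots> \<le> (8 * norm t) ^ n"
      by (intro power_mono small) auto
    finally show "norm (- (t ^ n / of_nat n) * laurent p ^ n) \<le> (8 * norm t) ^ n" .
    show "summable (\<lambda>n. (8 * norm t) ^ n)"
      using t by (intro summable_geometric) auto
  qed
  then have lim: "uniform_limit (cbox (0, 0) (1, 1)) f (\<lambda>p. Ln (1 - t * laurent p)) sequentially"
    using sums by (simp add: sums_iff)
  have "continuous_on (cbox (0, 0) (1, 1)) (f N)" for N
    unfolding f_def by (intro continuous_intros continuous_on_laurent)
  then obtain I J where I: "\<And>N. (f N has_integral I N) (cbox (0, 0) (1, 1))"
    and J: "((\<lambda>p. Ln (1 - t * laurent p)) has_integral J) (cbox (0, 0) (1, 1))"
    and IJ: "I \<longlonglongrightarrow> J"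
    using uniform_limit_integral_cbox [OF lim] by (metis sequentially_bot)
  have fN: "(f N has_integral (\<Sum>n<N. - (t ^ n / of_nat n) * of_nat (franel n))) (cbox (0, 0) (1, 1))" for N
    unfolding f_def by (intro has_integral_sum has_integral_mult_right has_integral_laurent_power) auto
  have "I = (\<lambda>N. \<Sum>n<N. - (t ^ n / of_nat n) * of_nat (franel n))"
    by (rule ext) (rule has_integral_unique [OF I fN])
  with IJ have "(\<lambda>n. - (t ^ n / of_nat n) * of_nat (franel n)) sums J"
    by (simp add: sums_def)
  then have "(\<lambda>n. - (franel_log_fps $ n * t ^ n)) sums J"
    by (simp add: franel_log_fps_def mult_ac)
  from sums_minus [OF this] have "- J = eval_fps franel_log_fps t"
    unfolding eval_fps_def by (simp add: sums_iff)
  then show ?thesis using J by (metis minus_minus)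
qed

text \<open>The factor x y / t contributes \<open>- ln (norm t)\<close>. The other factor avoids the
  branch cut, so the logarithm of its modulus is the real part of a continuous
  \<open>Ln\<close>.\<close>

lemma g_eq_eval_fps:
  assumes t: "t \<noteq> 0" "norm t < 1 / 8"
  shows "g t = - ln (norm t) - Re (eval_fps franel_log_fps t)"
proof -
  define S where "S = {0..1::real} \<times> {0..1::real}"
  have S: "S = cbox (0, 0) (1, 1)" by (simp add: S_def cbox_Pair_eq)
  define f where "f = (\<lambda>p. - ln (norm t) + Re (Ln (1 - t * laurent p)))"
  have small: "norm (t * laurent p) < 1" for p
  proof -
    have "norm (t * laurent p) \<le> norm t * 8"
      unfolding norm_mult by (intro mult_left_mono norm_laurent_le) auto
    then show ?thesis using t by simp
  qed
  have nz: "1 - t * laurent p \<notin> \<real>\<^sub>\<le>\<^sub>0" for p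
  proof
    assume "1 - t * laurent p \<in> \<real>\<^sub>\<le>\<^sub>0"
    then have "Re (t * laurent p) \<ge> 1" by (auto simp: complex_nonpos_Reals_iff)
    then show False using small [of p] complex_Re_le_cmod [of "t * laurent p"] by linarith
  qed
  have eq: "ln (cmod ((x + y) * (x + 1) * (y + 1) - (1 / t) * x * y)) = f p"
    if "x = cis (2 * pi * fst p)" "y = cis (2 * pi * snd p)" for x y p
  proof -
    have xy: "x \<noteq> 0" "y \<noteq> 0" "norm x = 1" "norm y = 1" using that by auto
    have "(x + y) * (x + 1) * (y + 1) - (1 / t) * x * y = - (x * y * (1 - t * laurent p) / t)"
      using that t xy by (simp add: laurent_def Let_def field_simps)
    then have "norm ((x + y) * (x + 1) * (y + 1) - (1 / t) * x * y) = norm (1 - t * laurent p) / norm t"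
      using xy by (simp add: norm_mult norm_divide)
    moreover have "1 - t * laurent p \<noteq> 0" using nz [of p] by auto
    ultimately show ?thesis using t by (simp add: f_def ln_div)
  qed
  have cont: "continuous_on S f"
    unfolding f_def using nz by (intro continuous_intros continuous_on_laurent) auto
  \<comment> \<open>Integrability identifies the Lebesgue integral in \<open>mahler2\<close> with
    the gauge integral in which the series was evaluated.\<close>
  have "set_integrable lborel S f"
    unfolding set_integrable_def using cont
    by (intro borel_integrable_compact) (auto simp: S compact_cbox)
  then have "g t = integral S f"
    unfolding g_def mahler2_def S_def [symmetric]
    by (simp only: eq [OF refl refl] set_borel_integral_eq_integral(2))
  moreover have "(f has_integral (- ln (norm t) + Re (- eval_fps franel_log_fps t))) S"
    unfolding f_def S using has_integral_const [of "- ln (norm t)" "(0, 0)" "(1, 1) :: real \<times> real"]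
    by (intro has_integral_add has_integral_Re has_integral_Ln_laurent t) (simp add: content_Pair)
  ultimately show ?thesis by (simp add: integral_unique)
qed

section \<open>Convergence and differentiation of the Franel series\<close>

lemma fps_conv_radius_ge_inverse:
  fixes f :: "complex fps"
  assumes "\<And>n. norm (f $ n) \<le> c ^ n" and "c > 0"
  shows "fps_conv_radius f \<ge> ereal (1 / c)"
  unfolding fps_conv_radius_def
proof (rule conv_radius_geI_ex)
  fix r assume r: "0 < r" "ereal r < ereal (1 / c)"
  have "summable (\<lambda>n. f $ n * of_real r ^ n)"
  proof (rule summable_comparison_test')
    show "summable (\<lambda>n. (c * r) ^ n)"
      using r assms(2) by (intro summable_geometric) (simp add: field_simps)
    show "norm (f $ n * of_real r ^ n) \<le> (c * r) ^ n" if "n \<ge> 0" for n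
      using r assms(1) by (simp add: norm_mult norm_power power_mult_distrib mult_right_mono)
  qed
  then show "\<exists>z. norm z = r \<and> summable (\<lambda>n. f $ n * z ^ n)"
    using r by (intro exI [of _ "of_real r"]) auto
qed

lemma franel_fps_conv_radius: "fps_conv_radius franel_fps \<ge> ereal (1 / 8)"
proof (rule fps_conv_radius_ge_inverse)
  fix n
  show "norm (franel_fps $ n) \<le> 8 ^ n"
    using of_nat_mono [OF franel_le [of n], where ?'a = real] by (simp add: franel_fps_def)
qed auto

lemma franel_log_fps_conv_radius: "fps_conv_radius franel_log_fps \<ge> ereal (1 / 8)"
proof (rule fps_conv_radius_ge_inverse)
  fix n
  have "real (franel n) / real n \<le> real (franel n)"
    using divide_left_mono [of 1 "real n" "real (franel n)"] by (cases "n = 0") auto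
  also have "\<dots> \<le> 8 ^ n"
    using of_nat_mono [OF franel_le [of n], where ?'a = real] by simp
  finally show "norm (franel_log_fps $ n) \<le> 8 ^ n"
    by (simp add: franel_log_fps_def norm_divide)
qed auto

text \<open>The operator t d/dt cancels the denominators n and recovers every term of the Franel
  series but the constant one.\<close>

lemma franel_log_fps_deriv:
  assumes "norm t < 1 / 8"
  shows "(eval_fps franel_log_fps has_field_derivative eval_fps (fps_deriv franel_log_fps) t) (at t)"
    and "t * eval_fps (fps_deriv franel_log_fps) t = eval_fps franel_fps t - 1"
proof -
  have t: "ereal (norm t) < fps_conv_radius franel_log_fps" "ereal (norm t) < fps_conv_radius franel_fps"
    using assms franel_log_fps_conv_radius franel_fps_conv_radius
    by (meson ereal_less(2) less_ereal.simps(1) order_less_le_trans)+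
  show "(eval_fps franel_log_fps has_field_derivative eval_fps (fps_deriv franel_log_fps) t) (at t)"
    by (rule has_field_derivative_eval_fps [OF t(1)])
  have "fps_X * fps_deriv franel_log_fps = franel_fps - 1"
    by (rule fps_ext) (auto simp: fps_mult_fps_X_deriv_shift franel_log_fps_def franel_fps_def franel_0)
  moreover have "ereal (norm t) < fps_conv_radius (fps_deriv franel_log_fps)"
    using t(1) fps_conv_radius_deriv [of franel_log_fps] by (rule order_less_le_trans)
  then have "eval_fps (fps_X * fps_deriv franel_log_fps) t = t * eval_fps (fps_deriv franel_log_fps) t"
    by (subst eval_fps_mult) auto
  moreover have "eval_fps (franel_fps - 1) t = eval_fps franel_fps t - 1"
    using t(2) by (subst eval_fps_diff) auto
  ultimately show "t * eval_fps (fps_deriv franel_log_fps) t = eval_fps franel_fps t - 1"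
    by simp
qed

section \<open>Third roots of unity\<close>

lemma zeta3_sum: "zeta3 ^ 2 + zeta3 + 1 = 0"
proof -
  have z: "zeta3 = Complex (- 1 / 2) (sqrt 3 / 2)"
    by (simp add: zeta3_def complex_eq_iff cos_120 sin_120)
  show ?thesis
    unfolding z by (simp add: complex_eq_iff power2_eq_square)
qed

lemma norm_zeta3: "norm zeta3 = 1" by (simp add: zeta3_def)

lemma zeta3_cube: "zeta3 ^ 3 = 1"
proof -
  have "zeta3 ^ 3 - 1 = (zeta3 - 1) * (zeta3 ^ 2 + zeta3 + 1)"
    by (simp add: algebra_simps power2_eq_square power3_eq_cube)
  then show ?thesis by (simp add: zeta3_sum)
qed

text \<open>Both sides have the same formal expansion at the origin, hence agree near it.\<close>

lemma eventually_franel_cubic_transformation: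
  "\<forall>\<^sub>F t in nhds 0. eval_fps franel_fps (Y t) = (1 + 2 * t + 4 * t ^ 2) * eval_fps franel_fps (t ^ 3)"
proof -
  define F where "F = eval_fps franel_fps"
  have F: "F has_fps_expansion franel_fps"
    unfolding F_def using franel_fps_conv_radius
    by (intro eval_fps_has_fps_expansion) (metis ereal_less(2) less_le_trans zero_less_divide_1_iff zero_less_numeral)
  have Y: "Y has_fps_expansion Y_fps"
    unfolding Y_fps_def Y_def [abs_def] by (intro fps_expansion_intros) simp
  have Y0: "Y_fps $ 0 = 0"
    by (simp add: Y_fps_def fps_divide_unit)
  have "(F \<circ> Y) has_fps_expansion (franel_fps oo Y_fps)"
    by (rule has_fps_expansion_compose [OF F Y Y0])
  moreover have "(\<lambda>t. (1 + 2 * t + 4 * t ^ 2) * (F \<circ> (\<lambda>t. t ^ 3)) t) has_fps_expansion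
      (1 + 2 * fps_X + 4 * fps_X ^ 2) * (franel_fps oo fps_X ^ 3)"
    by (intro fps_expansion_intros F) simp
  ultimately have "\<forall>\<^sub>F t in nhds 0. eval_fps (franel_fps oo Y_fps) t = (F \<circ> Y) t"
    "\<forall>\<^sub>F t in nhds 0. eval_fps (franel_fps oo Y_fps) t = (1 + 2 * t + 4 * t ^ 2) * (F \<circ> (\<lambda>t. t ^ 3)) t"
    unfolding franel_fps_cubic_transformation [symmetric] has_fps_expansion_def by blast+
  then show ?thesis
    by eventually_elim (simp add: F_def)
qed

section \<open>Averaging over the rotations\<close>

theorem mainTheorem8:
  shows "\<forall>\<^sub>F u in at (0::complex). g (u ^ 3) = (\<Sum>j<3::nat. g (Y (zeta3 ^ j * u)))"
proof -
  define F where "F = eval_fps franel_fps"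
  define S where "S = eval_fps franel_log_fps"
  define S' where "S' = eval_fps (fps_deriv franel_log_fps)"
  define v where "v = (\<lambda>t :: complex. 1 - t + t ^ 2)"
  define w where "w = (\<lambda>t :: complex. 1 + 2 * t + 4 * t ^ 2)"
  \<comment> \<open>Splitting \<open>t\<close> off \<open>Y t\<close> leaves a quotient with value 1
    at the origin, whose principal logarithm is holomorphic there.\<close>
  define h where "h = (\<lambda>t. S (Y t) + Ln (v t / w t))"
  \<comment> \<open>All conditions hold near the origin, so one radius serves \<open>u\<close> and
    its rotations, which have the same norm.\<close>
  define good where "good = (\<lambda>t. norm (Y t) < 1 / 8 \<and> norm (t ^ 3) < 1 / 8 \<and> v t \<noteq> 0 \<and> w t \<noteq> 0 \<and>
    1 + t \<noteq> 0 \<and> v t / w t \<notin> \<real>\<^sub>\<le>\<^sub>0 \<and> F (Y t) = w t * F (t ^ 3))"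
  have "\<forall>\<^sub>F t in nhds 0. good t"
  proof -
    have ev: "\<forall>\<^sub>F t in nhds 0. f t \<in> A" if "isCont f 0" "open A" "f 0 \<in> A" for f :: "complex \<Rightarrow> complex" and A
    proof -
      have "(f \<longlongrightarrow> f 0) (nhds 0)"
        using that(1) by (simp add: isCont_def tendsto_at_iff_tendsto_nhds)
      then show ?thesis using that(2,3) by (rule topological_tendstoD)
    qed
    have "isCont Y 0" unfolding Y_def [abs_def] by (intro continuous_intros) auto
    then have "\<forall>\<^sub>F t in nhds 0. Y t \<in> ball 0 (1 / 8)" by (rule ev) (auto simp: Y_def)
    moreover have "\<forall>\<^sub>F t in nhds 0. t ^ 3 \<in> ball (0::complex) (1 / 8)"
      by (rule ev) (auto intro!: continuous_intros)
    moreover have "\<forall>\<^sub>F t in nhds 0. v t \<in> - {0}"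
      by (rule ev) (auto simp: v_def intro!: continuous_intros)
    moreover have "\<forall>\<^sub>F t in nhds 0. w t \<in> - {0}"
      by (rule ev) (auto simp: w_def intro!: continuous_intros)
    moreover have "\<forall>\<^sub>F t in nhds 0. 1 + t \<in> - {0 :: complex}"
      by (rule ev) (auto intro!: continuous_intros)
    moreover have "\<forall>\<^sub>F t in nhds 0. v t / w t \<in> - \<real>\<^sub>\<le>\<^sub>0"
      by (rule ev) (auto simp: v_def w_def intro!: continuous_intros)
    moreover note eventually_franel_cubic_transformation
    ultimately show ?thesis
      by eventually_elim (auto simp: good_def F_def w_def)
  qed
  then obtain r where r: "r > 0" and good: "\<And>t. norm t < r \<Longrightarrow> good t"
    by (auto simp: eventually_nhds_metric)
  have norm_rot: "norm (zeta3 ^ j * u) = norm u" for j u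
    by (simp add: norm_mult norm_power norm_zeta3)
  have rot_cube: "(zeta3 ^ j * u) ^ 3 = u ^ 3" for j u
    using zeta3_cube by (metis mult_1 power_mult_distrib power_commutes power_mult power_one mult.commute)
  \<comment> \<open>By the cubic transformation \<open>F\<close> enters only through
    \<open>F (t ^ 3)\<close>, which is the same for all rotations of \<open>t\<close>.\<close>
  have h_deriv: "\<exists>D. (h has_field_derivative D) (at t) \<and>
      t * D = ((1 + t) * (1 - 2 * t)) ^ 2 / v t * F (t ^ 3) - 1" if "norm t < r" for t
  proof -
    have t: "norm (Y t) < 1 / 8" "v t \<noteq> 0" "w t \<noteq> 0" "v t / w t \<notin> \<real>\<^sub>\<le>\<^sub>0" "F (Y t) = w t * F (t ^ 3)"
      using good [OF that] by (auto simp: good_def)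
    define a where "a = (1 + t) * (1 - 2 * t)"
    have dY: "(Y has_field_derivative a ^ 2 / w t ^ 2) (at t)"
    proof -
      have "((\<lambda>t. t * v t / w t) has_field_derivative
          ((v t + t * (2 * t - 1)) * w t - t * v t * (2 + 8 * t)) / (w t * w t)) (at t)"
        unfolding v_def w_def using t(3)
        by (auto intro!: derivative_eq_intros simp: w_def)
      moreover have "(v t + t * (2 * t - 1)) * w t - t * v t * (2 + 8 * t) = a ^ 2"
        unfolding v_def w_def a_def by algebra
      ultimately show ?thesis
        by (simp add: Y_def [abs_def] v_def w_def power2_eq_square)
    qed
    have dvw: "((\<lambda>t. v t / w t) has_field_derivative ((2 * t - 1) * w t - v t * (2 + 8 * t)) / (w t * w t)) (at t)"
      unfolding v_def w_def using t(3)
      by (auto intro!: derivative_eq_intros simp: w_def)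
    define D where "D = S' (Y t) * (a ^ 2 / w t ^ 2)
      + ((2 * t - 1) * w t - v t * (2 + 8 * t)) / (w t * w t) / (v t / w t)"
    have "(h has_field_derivative D) (at t)"
      unfolding h_def D_def S_def S'_def
      using DERIV_add [OF DERIV_chain2 [OF franel_log_fps_deriv(1) [OF t(1)] dY]
          DERIV_chain2 [OF has_field_derivative_Ln [OF t(4)] dvw]]
      by (simp add: divide_inverse mult_ac)
    moreover have "t * D = a ^ 2 / v t * F (t ^ 3) - 1"
    proof -
      define z where "z = S' (Y t)"
      have "Y t * z = w t * F (t ^ 3) - 1"
        using franel_log_fps_deriv(2) [OF t(1)] t(5) by (simp add: z_def S'_def F_def)
      moreover have "Y t = t * v t / w t" by (simp add: Y_def v_def w_def)
      ultimately have "t * z = w t * (w t * F (t ^ 3) - 1) / v t"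
        using t(2,3) by (simp add: field_simps)
      then have "t * D = w t * (w t * F (t ^ 3) - 1) / v t * (a ^ 2 / w t ^ 2)
          + t * (((2 * t - 1) * w t - v t * (2 + 8 * t)) / (w t * w t) / (v t / w t))"
        unfolding D_def z_def by (simp add: distrib_left mult.assoc [symmetric])
      \<comment> \<open>The part without \<open>F\<close> is t times the logarithmic derivative of
        \<open>v t / w t\<close> minus that of \<open>Y t\<close>. It is -1 because
        \<open>Y t = t * (v t / w t)\<close>.\<close>
      also have "\<dots> = a ^ 2 / v t * F (t ^ 3)
          + (t * ((2 * t - 1) * w t - v t * (2 + 8 * t)) - a ^ 2) / (v t * w t)"
        using t(2,3) by (simp add: field_simps power2_eq_square)
      also have "t * ((2 * t - 1) * w t - v t * (2 + 8 * t)) - a ^ 2 = - (v t * w t)"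
        unfolding v_def w_def a_def by algebra
      finally show ?thesis using t(2,3) by simp
    qed
    ultimately show ?thesis unfolding a_def by blast
  qed
  \<comment> \<open>The terms 3 ln |u| agree on both sides of the theorem, so the difference of the
    sides is minus the real part of \<Phi>, which is holomorphic at 0 as well.\<close>
  define \<Phi> where "\<Phi> = (\<lambda>u. S (u ^ 3) - (\<Sum>j<3. h (zeta3 ^ j * u)))"
  have \<Phi>_deriv: "\<exists>D. (\<Phi> has_field_derivative D) (at u) \<and> u * D = 0" if u: "norm u < r" for u
  proof -
    obtain d where d: "\<And>t. norm t < r \<Longrightarrow> (h has_field_derivative d t) (at t)"
      "\<And>t. norm t < r \<Longrightarrow> t * d t = ((1 + t) * (1 - 2 * t)) ^ 2 / v t * F (t ^ 3) - 1"
      using h_deriv by metis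
    have u3: "norm (u ^ 3) < 1 / 8" using good [OF u] by (simp add: good_def)
    define D where "D = S' (u ^ 3) * (3 * u ^ 2) - (\<Sum>j<3. d (zeta3 ^ j * u) * zeta3 ^ j)"
    have "((\<lambda>u. S (u ^ 3)) has_field_derivative S' (u ^ 3) * (3 * u ^ 2)) (at u)"
      unfolding S_def S'_def
      by (rule DERIV_chain2 [where g = "\<lambda>u. u ^ 3", OF franel_log_fps_deriv(1) [OF u3]]) (auto intro!: derivative_eq_intros)
    moreover have "((\<lambda>u. h (zeta3 ^ j * u)) has_field_derivative d (zeta3 ^ j * u) * zeta3 ^ j) (at u)" for j
      by (rule DERIV_chain2 [where g = "\<lambda>u. zeta3 ^ j * u", OF d(1)]) (use u in \<open>auto intro!: derivative_eq_intros simp: norm_rot\<close>)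
    ultimately have "(\<Phi> has_field_derivative D) (at u)"
      unfolding \<Phi>_def D_def by (intro DERIV_diff DERIV_sum)
    moreover have "u * D = 0"
    proof -
      \<comment> \<open>Extending the fraction by 1 + t turns the denominator into 1 + t^3 = 1 +
        u^3, common to all rotations.\<close>
      have summand: "zeta3 ^ j * u * d (zeta3 ^ j * u) =
          (1 + zeta3 ^ j * u) ^ 3 * (1 - 2 * (zeta3 ^ j * u)) ^ 2 / (1 + u ^ 3) * F (u ^ 3) - 1" for j
      proof -
        define t where "t = zeta3 ^ j * u"
        have t: "norm t < r" "t ^ 3 = u ^ 3" using u by (simp_all add: t_def norm_rot rot_cube)
        have nz: "v t \<noteq> 0" "1 + t \<noteq> 0" using good [OF t(1)] by (auto simp: good_def)
        have "1 + u ^ 3 = (1 + t) * v t" unfolding t(2) [symmetric] v_def by algebra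
        moreover have "(1 + t) ^ 3 * (1 - 2 * t) ^ 2 = (1 + t) * ((1 + t) * (1 - 2 * t)) ^ 2" by algebra
        ultimately have "((1 + t) * (1 - 2 * t)) ^ 2 / v t = (1 + t) ^ 3 * (1 - 2 * t) ^ 2 / (1 + u ^ 3)"
          using nz by simp
        then show ?thesis using d(2) [OF t(1)] t(2) by (simp add: t_def)
      qed
      have nz: "1 + u ^ 3 \<noteq> 0"
      proof -
        have "1 + u ^ 3 = (1 + u) * v u" unfolding v_def by algebra
        then show ?thesis using good [OF u] by (simp add: good_def)
      qed
      \<comment> \<open>Grouping by exponents modulo 3 isolates the part 1 + t^3 that survives the
        average; the other two carry factors t and t^2 whose sums over the rotations vanish.\<close>
      have reduce: "(1 + t) ^ 3 * (1 - 2 * t) ^ 2 = (1 + t ^ 3) + (8 * t ^ 3 - 1) * t + (4 * t ^ 3 - 5) * t ^ 2"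
        for t :: complex by algebra
      have sum3: "(\<Sum>j<3. f j) = f 0 + f 1 + f 2" for f :: "nat \<Rightarrow> complex"
        by (simp add: eval_nat_numeral)
      have z4: "zeta3 ^ 4 = zeta3" using zeta3_cube by (simp add: eval_nat_numeral)
      have "(\<Sum>j<3. zeta3 ^ j * u) = (zeta3 ^ 2 + zeta3 + 1) * u"
        unfolding sum3 by (simp add: algebra_simps)
      moreover have "(\<Sum>j<3. (zeta3 ^ j * u) ^ 2) = (zeta3 ^ 2 + zeta3 ^ 4 + 1) * u ^ 2"
        unfolding sum3 by (simp add: algebra_simps power_mult_distrib flip: power_mult)
      ultimately have sums: "(\<Sum>j<3. zeta3 ^ j * u) = 0" "(\<Sum>j<3. (zeta3 ^ j * u) ^ 2) = 0"
        unfolding z4 zeta3_sum by simp_all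
      have "(\<Sum>j<3. (1 + zeta3 ^ j * u) ^ 3 * (1 - 2 * (zeta3 ^ j * u)) ^ 2) = 3 * (1 + u ^ 3)"
        unfolding reduce rot_cube sum.distrib sum_distrib_left [symmetric] sums by simp
      then have "(\<Sum>j<3. zeta3 ^ j * u * d (zeta3 ^ j * u)) = 3 * F (u ^ 3) - 3"
        unfolding summand using nz
        by (simp add: sum_subtractf flip: sum_distrib_right sum_divide_distrib)
          (simp add: field_simps)
      moreover have "u ^ 3 * S' (u ^ 3) = F (u ^ 3) - 1"
        using franel_log_fps_deriv(2) [OF u3] by (simp add: S'_def F_def)
      moreover have "u * D = 3 * (u ^ 3 * S' (u ^ 3)) - (\<Sum>j<3. zeta3 ^ j * u * d (zeta3 ^ j * u))"
        unfolding D_def by (simp add: right_diff_distrib sum_distrib_left mult_ac power2_eq_square power3_eq_cube)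
      ultimately show ?thesis by simp
    qed
    ultimately show ?thesis by blast
  qed
  \<comment> \<open>\<open>u * D = 0\<close> gives a zero derivative only away from 0; continuity
    covers the exceptional point.\<close>
  have "\<Phi> constant_on ball 0 r"
  proof (rule DERIV_zero_connected_constant_on)
    show "finite {0::complex}" by simp
    show "continuous_on (ball 0 r) \<Phi>"
      using \<Phi>_deriv by (meson DERIV_isCont continuous_at_imp_continuous_on mem_ball_0)
    show "\<forall>u\<in>ball 0 r - {0}. (\<Phi> has_field_derivative 0) (at u)"
      using \<Phi>_deriv by fastforce
  qed auto
  moreover have "\<Phi> 0 = 0"
    by (simp add: \<Phi>_def h_def S_def Y_def v_def w_def eval_fps_at_0 franel_log_fps_def)
  ultimately have \<Phi>0: "\<Phi> u = 0" if "norm u < r" for u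
    using that r by (auto simp: constant_on_def)
  have "g (u ^ 3) = (\<Sum>j<3. g (Y (zeta3 ^ j * u)))" if u: "u \<noteq> 0" "norm u < r" for u
  proof -
    have gY: "g (Y t) = - ln (norm u) - Re (h t)" if "norm t = norm u" for t
    proof -
      have t: "norm (Y t) < 1 / 8" "v t \<noteq> 0" "w t \<noteq> 0" "t \<noteq> 0"
        using good [of t] u that by (auto simp: good_def)
      have Y: "Y t = t * (v t / w t)" by (simp add: Y_def v_def w_def)
      have "ln (norm (Y t)) = ln (norm u) + Re (Ln (v t / w t))"
        using t u by (simp add: Y norm_mult norm_divide that ln_mult ln_div)
      moreover have "Y t \<noteq> 0" using t by (simp add: Y)
      ultimately show ?thesis
        using t(1) by (simp add: g_eq_eval_fps h_def S_def)
    qed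
    have "norm (u ^ 3) < 1 / 8" using good [OF u(2)] by (simp add: good_def)
    then have "g (u ^ 3) = - 3 * ln (norm u) - Re (S (u ^ 3))"
      using u by (simp add: g_eq_eval_fps S_def norm_power ln_realpow)
    also have "S (u ^ 3) = (\<Sum>j<3. h (zeta3 ^ j * u))"
      using \<Phi>0 [OF u(2)] by (simp add: \<Phi>_def)
    also have "- 3 * ln (norm u) - Re (\<Sum>j<3. h (zeta3 ^ j * u)) = (\<Sum>j<3. g (Y (zeta3 ^ j * u)))"
      by (simp add: gY norm_rot sum_subtractf)
    finally show ?thesis .
  qed
  then show ?thesis
    unfolding eventually_at using r by (auto simp: dist_norm)
qed

end
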